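(* Let $\mathbb X,\mathbb D,\Phi_{ad},j,\{a_k\},\{\lambda_k\}$ satisfy assumptions (A1)–(A12) listed in the context, and let $\{\varphi_k\}_{k\ge 0}\subseteq\Phi_{ad}$ be the sequence generated by the VMPT method (described in the context) with $\mathrm{tol}=0$, with search directions $v_k$. Then: 1. $\lim_{k\to\infty} j(\varphi_k)$ exists. 2. Every accumulation point of $\{\varphi_k\}$ in $\mathbb X\cap\mathbb D$ (with respect to the norm $\|\cdot\|_{\mathbb X\cap\mathbb D}$) is a stationary point of $j$. 3. For every subsequence with $\varphi_{k_i}\to\varphi$ in $\mathbb X\cap\mathbb D$, where $\varphi$ is a stationary point of $j$, the subsequence $\{v_{k_i}\}_i$ converges strongly to zero in $\mathbb X$. 4. If additionally $j\in C^{1,\gamma}(\Phi_{ad})$ with respect to $\|\cdot\|_{\mathbb X\cap\mathbb D}$ for some $0<\gamma\le 1$ (i.e. there is $L\ge 0$ with $\|j'(\varphi)-j'(\psi)\|_{(\mathbb X\cap\mathbb D)^*}\le L\|\varphi-\psi\|_{\mathbb X\cap\mathbb D}^{\gamma}$ for all $\varphi,\psi\in\Phi_{ad}$), then the whole sequence $\{v_k\}_k$ converges to zero in $\mathbb X$.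
   Context: Setting. $\mathbb X$ and $\mathbb D$ are real Banach spaces contained as linear subspaces in a common vector space, and $\mathbb X\cap\mathbb D$ carries the norm $\|\cdot\|_{\mathbb X\cap\mathbb D}=\|\cdot\|_{\mathbb X}+\|\cdot\|_{\mathbb D}$. $\langle\cdot,\cdot\rangle$ is the dual pairing between $(\mathbb X\cap\mathbb D)^*$ and $\mathbb X\cap\mathbb D$. $\Phi_{ad}\subseteq\mathbb X\cap\mathbb D$, $j$ is a real-valued functional, and $j'(\varphi)\in(\mathbb X\cap\mathbb D)^*$ is its Fréchet derivative. For a symmetric positive definite bilinear form $a_k$ write $\|p\|_{a_k}=a_k(p,p)^{1/2}$. A point $\varphi\in\Phi_{ad}$ is a stationary point of $j$ if $\langle j'(\varphi),\eta-\varphi\rangle\ge0$ for all $\eta\in\Phi_{ad}$. Assumptions. (A1) $\mathbb X$ is reflexive; $\mathbb D$ is isometrically isomorphic to (and identified with) $\mathbb B^*$ for a separable Banach space $\mathbb B$, and weak-* convergence in $\mathbb D$ means weak-* convergence in $\mathbb B^*$. If $\{\varphi_i\}\subseteq\mathbb X\cap\mathbb D$ satisfies $\varphi_i\to\varphi$ weakly in $\mathbb X$ and $\varphi_i\to\tilde\varphi$ weakly-* in $\mathbb D$, then $\varphi=\tilde\varphi$. (A2) $\Phi_{ad}\subseteq\mathbb X\cap\mathbb D$ is convex, closed in $\mathbb X$ and non-empty. (A3) $\Phi_{ad}$ is bounded in $\mathbb D$. (A4) There is $C>0$ with $j(\varphi)\ge -C$ for all $\varphi\in\Phi_{ad}$.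 (A5) $j$ is continuously Fréchet differentiable in a neighbourhood of $\Phi_{ad}$ in $\mathbb X\cap\mathbb D$. (A6) For each $\varphi\in\Phi_{ad}$ and each sequence $\{\varphi_i\}\subseteq\mathbb X\cap\mathbb D$ with $\varphi_i\to0$ weakly in $\mathbb X$ and weakly-* in $\mathbb D$, one has $\langle j'(\varphi),\varphi_i\rangle\to0$. (A7) $\{a_k\}_{k\in\mathbb N_0}$ is a sequence of symmetric positive definite bilinear forms on $\mathbb X\cap\mathbb D$. (A8) There is $c_1>0$ with $c_1\|p\|_{\mathbb X}^2\le\|p\|_{a_k}^2$ for all $p\in\mathbb X\cap\mathbb D$, $k\in\mathbb N_0$. (A9) For each $k\in\mathbb N_0$ there is $c_2=c_2(k)$ with $\|p\|_{a_k}^2\le c_2\|p\|_{\mathbb X\cap\mathbb D}^2$ for all $p\in\mathbb X\cap\mathbb D$. (A10) For all $k\in\mathbb N_0$, $p\in\Phi_{ad}$ and each sequence $\{y_i\}\subseteq\Phi_{ad}$ for which there is $y\in\mathbb X\cap\mathbb D$ with $y_i\to y$ weakly in $\mathbb X$ and weakly-* in $\mathbb D$, one has $a_k(p,y_i)\to a_k(p,y)$. (A11) For each subsequence $\{\varphi_{k_i}\}_i$ of the iterates of the VMPT method that converges in $\mathbb X\cap\mathbb D$, the corresponding $\{a_{k_i}\}_i$ satisfies $a_{k_i}(p_i,y_i)\to0$ for all sequences $\{p_i\},\{y_i\}\subseteq\mathbb X\cap\mathbb D$ with $p_i\to0$ strongly in $\mathbb X$ and weakly-* in $\mathbb D$ and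 $\{y_i\}$ converging in $\mathbb X\cap\mathbb D$. (A12) There are constants with $0<\lambda_{min}\le\lambda_k\le\lambda_{max}$ for all $k\in\mathbb N_0$. VMPT method. Fix $0<\beta<1$, $0<\sigma<1$, $\varphi_0\in\Phi_{ad}$, $\mathrm{tol}\ge0$. For $k=0,1,2,\dots$: choose $\lambda_k$ and $a_k$ (they may depend on the iterates computed so far); let $\overline\varphi_k$ be the (unique) minimizer of $y\mapsto\frac12\|y-\varphi_k\|_{a_k}^2+\lambda_k\langle j'(\varphi_k),y-\varphi_k\rangle$ over $y\in\Phi_{ad}$; set $v_k=\overline\varphi_k-\varphi_k$; stop if $\|v_k\|_{\mathbb X}\le\mathrm{tol}$; otherwise let $\alpha_k=\beta^{m_k}$ with $m_k\in\mathbb N_0$ minimal such that $j(\varphi_k+\alpha_kv_k)\le j(\varphi_k)+\alpha_k\sigma\langle j'(\varphi_k),v_k\rangle$, and set $\varphi_{k+1}=\varphi_k+\alpha_kv_k$. No upper bound is imposed on the number of iterations, and the method is assumed not to stop, so that an infinite sequence is generated. *)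

theory Defs
  imports "HOL-Analysis.Analysis"
begin

text \<open>
  Two Banach spaces are given by the types of \<open>iX\<close> and \<open>iD\<close>, which embed them as linear subspaces
  in a common vector space (without topology). The intersection of the two subspaces, equipped with
  the sum norm, is the normed space \<open>'w\<close>; \<open>pX\<close> and \<open>pD\<close> view an element of the intersection
  as an element of \<open>'x\<close> and of \<open>'d\<close>. The assumption \<open>ex_common\<close> says that every vector lying in both
  subspaces occurs in \<open>'w\<close>; by \<open>norm_sum\<close> it occurs only once. Completeness of \<open>'w\<close> is not assumed.
\<close>

locale banach_intersection =
  fixes iX :: "'x::banach \<Rightarrow> 'v::real_vector"
    and iD :: "'d::banach \<Rightarrow> 'v"
    and pX :: "'w::real_normed_vector \<Rightarrow> 'x"
    and pD :: "'w \<Rightarrow> 'd"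
  assumes linear_iX: "linear iX" and inj_iX: "inj iX"
    and linear_iD: "linear iD" and inj_iD: "inj iD"
    and linear_pX: "linear pX" and linear_pD: "linear pD"
    and same_vector: "iX (pX w) = iD (pD w)"
    and ex_common: "iX x = iD d \<Longrightarrow> \<exists>w. pX w = x \<and> pD w = d"
    and norm_sum: "norm w = norm (pX w) + norm (pD w)"

definition reflexive_space :: "'x::real_normed_vector itself \<Rightarrow> bool" where
  "reflexive_space _ \<longleftrightarrow>
    (\<forall>F :: ('x \<Rightarrow>\<^sub>L real) \<Rightarrow>\<^sub>L real. \<exists>x. \<forall>f. blinfun_apply F f = blinfun_apply f x)"

definition isometric_isomorphism :: "('a::real_normed_vector \<Rightarrow> 'b::real_normed_vector) \<Rightarrow> bool" where
  "isometric_isomorphism J \<longleftrightarrow> linear J \<and> surj J \<and> (\<forall>x. norm (J x) = norm x)"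

definition weak_lim :: "(nat \<Rightarrow> 'x::real_normed_vector) \<Rightarrow> 'x \<Rightarrow> bool" where
  "weak_lim u l \<longleftrightarrow>
    (\<forall>f :: 'x \<Rightarrow>\<^sub>L real. (\<lambda>i. blinfun_apply f (u i)) \<longlonglongrightarrow> blinfun_apply f l)"

text \<open>Weak-* convergence in a space identified via \<open>J\<close> with the dual of \<open>'b\<close>.\<close>

definition weak_star_lim ::
    "('d \<Rightarrow> ('b::real_normed_vector \<Rightarrow>\<^sub>L real)) \<Rightarrow> (nat \<Rightarrow> 'd) \<Rightarrow> 'd \<Rightarrow> bool" where
  "weak_star_lim J u l \<longleftrightarrow>
    (\<forall>b. (\<lambda>i. blinfun_apply (J (u i)) b) \<longlonglongrightarrow> blinfun_apply (J l) b)"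

definition sym_pos_def_form :: "('w::real_vector \<Rightarrow> 'w \<Rightarrow> real) \<Rightarrow> bool" where
  "sym_pos_def_form a \<longleftrightarrow>
    bilinear a \<and> (\<forall>p q. a p q = a q p) \<and> (\<forall>p. p \<noteq> 0 \<longrightarrow> a p p > 0)"

definition form_norm :: "('w \<Rightarrow> 'w \<Rightarrow> real) \<Rightarrow> 'w \<Rightarrow> real" where
  "form_norm a p = sqrt (a p p)"

definition stationary_point ::
    "'w::real_normed_vector set \<Rightarrow> ('w \<Rightarrow> ('w \<Rightarrow>\<^sub>L real)) \<Rightarrow> 'w \<Rightarrow> bool" where
  "stationary_point \<Phi> j' \<phi> \<longleftrightarrow>
    \<phi> \<in> \<Phi> \<and> (\<forall>\<eta>\<in>\<Phi>. blinfun_apply (j' \<phi>) (\<eta> - \<phi>) \<ge> 0)"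

definition accumulation_point :: "(nat \<Rightarrow> 'w::topological_space) \<Rightarrow> 'w \<Rightarrow> bool" where
  "accumulation_point s l \<longleftrightarrow> (\<exists>r. strict_mono (r :: nat \<Rightarrow> nat) \<and> (s \<circ> r) \<longlonglongrightarrow> l)"

definition armijo_cond ::
    "('w::real_normed_vector \<Rightarrow> real) \<Rightarrow> ('w \<Rightarrow> ('w \<Rightarrow>\<^sub>L real)) \<Rightarrow> real \<Rightarrow> 'w \<Rightarrow> 'w \<Rightarrow> real \<Rightarrow> bool" where
  "armijo_cond j j' \<sigma> \<phi> v \<alpha> \<longleftrightarrow>
    j (\<phi> + \<alpha> *\<^sub>R v) \<le> j \<phi> + \<alpha> * \<sigma> * blinfun_apply (j' \<phi>) v"

text \<open>
  One non-stopping iteration of the method with form \<open>a\<close> and parameter \<open>lam\<close>: from the iterate \<open>\<phi>\<close>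
  it computes the search direction \<open>v\<close> and the next iterate \<open>\<psi>\<close>.
\<close>

definition vmpt_step ::
    "('w::real_normed_vector \<Rightarrow> 'x::real_normed_vector) \<Rightarrow> 'w set \<Rightarrow> ('w \<Rightarrow> real) \<Rightarrow> ('w \<Rightarrow> ('w \<Rightarrow>\<^sub>L real))
      \<Rightarrow> real \<Rightarrow> real \<Rightarrow> real \<Rightarrow> ('w \<Rightarrow> 'w \<Rightarrow> real) \<Rightarrow> real \<Rightarrow> 'w \<Rightarrow> 'w \<Rightarrow> 'w \<Rightarrow> bool" where
  "vmpt_step pX \<Phi> j j' \<beta> \<sigma> tol a lam \<phi> v \<psi> \<longleftrightarrow>
    (\<exists>\<phi>bar m.
      is_arg_min (\<lambda>y. 1/2 * (form_norm a (y - \<phi>))\<^sup>2 + lam * blinfun_apply (j' \<phi>) (y - \<phi>))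
        (\<lambda>y. y \<in> \<Phi>) \<phi>bar \<and>
      v = \<phi>bar - \<phi> \<and>
      \<not> norm (pX v) \<le> tol \<and>
      armijo_cond j j' \<sigma> \<phi> v (\<beta> ^ m) \<and>
      (\<forall>n<m. \<not> armijo_cond j j' \<sigma> \<phi> v (\<beta> ^ n)) \<and>
      \<psi> = \<phi> + \<beta> ^ m *\<^sub>R v)"

text \<open>
  Infinite run of the method. Any dependence of the choices \<open>a k\<close> and \<open>lam k\<close> on earlier
  iterates is covered, since these are the forms and parameters actually used along the run.
\<close>

definition vmpt_run ::
    "('w::real_normed_vector \<Rightarrow> 'x::real_normed_vector) \<Rightarrow> 'w set \<Rightarrow> ('w \<Rightarrow> real) \<Rightarrow> ('w \<Rightarrow> ('w \<Rightarrow>\<^sub>L real))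
      \<Rightarrow> real \<Rightarrow> real \<Rightarrow> real \<Rightarrow> (nat \<Rightarrow> 'w \<Rightarrow> 'w \<Rightarrow> real) \<Rightarrow> (nat \<Rightarrow> real)
      \<Rightarrow> (nat \<Rightarrow> 'w) \<Rightarrow> (nat \<Rightarrow> 'w) \<Rightarrow> bool" where
  "vmpt_run pX \<Phi> j j' \<beta> \<sigma> tol a lam \<phi> v \<longleftrightarrow>
    \<phi> 0 \<in> \<Phi> \<and>
    (\<forall>k. vmpt_step pX \<Phi> j j' \<beta> \<sigma> tol (a k) (lam k) (\<phi> k) (v k) (\<phi> (Suc k)))"

end

theory Submission
  imports Defs "HOL-Complex_Analysis.Great_Picard"
begin

text \<open>
  The quantity to watch is the descent \<open>\<delta> k = - j' (\<phi> k) (v k)\<close>. Testing the variational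
  inequality of the quadratic subproblem (\<open>variational_inequality\<close>) with the current iterate shows
  that \<open>\<delta> k\<close> is nonnegative and bounds the square of the \<open>'x\<close>-norm of \<open>v k\<close> up to a constant. So
  every step decreases \<open>j\<close>, the values converge because \<open>j\<close> is bounded below on \<open>\<Phi>\<close>, and the
  directions tend to zero in \<open>'x\<close> wherever \<open>\<delta>\<close> does.

  The step length cannot spoil this. By the mean value theorem backtracking accepts every length up
  to which the slope of \<open>j\<close> in direction \<open>v k\<close> has changed only by a fixed fraction of \<open>\<delta> k\<close>
  (\<open>armijo_step_lower_bound\<close>). If infinitely many iterates had \<open>\<delta> k\<close> bounded away from zero
  and admitted one such length in common, each of them would decrease \<open>j\<close> by a fixed amount, which
  contradicts the convergence of the values (\<open>eventually_not_controlled\<close>). A common length is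
  available in two situations. Along a subsequence that converges in the intersection, the
  directions are bounded and \<open>j'\<close> is continuous at the limit; hence \<open>\<delta>\<close>, and with it the
  directions, tend to zero there (\<open>descent_null\<close>, \<open>direction_null\<close>). If \<open>j'\<close> is Hoelder continuous on \<open>\<Phi>\<close>, the same length serves all
  iterates whose direction has \<open>'x\<close>-norm at least \<open>\<epsilon>\<close>, so the whole sequence of
  directions tends to zero (\<open>all_directions_null\<close>).

  Stationarity of an accumulation point is the limit of the variational inequalities
  (\<open>limit_stationary\<close>). The cross terms \<open>a k (v k) (\<eta> - \<phi> k)\<close> disappear by the assumption on
  varying forms, provided that \<open>v k\<close> tends to zero weakly-* in \<open>'d\<close> as well. It does: the directions
  are bounded in \<open>'d\<close>, so by sequential weak-* compactness every subsequence has a weak-* convergent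
  one, and its limit is zero because weak limits in \<open>'x\<close> and weak-* limits in \<open>'d\<close> agree
  (\<open>weak_star_null_if_strong_null_bounded\<close>).
\<close>

section \<open>Weak-* compactness in the dual of a separable space\<close>

text \<open>
  Sequential Banach--Alaoglu: a diagonal argument gives convergence on a countable dense set, and
  the uniform bound on the norms carries it over to the whole space.
\<close>

lemma weak_star_convergent_subsequence:
  fixes f :: "nat \<Rightarrow> ('b::real_normed_vector \<Rightarrow>\<^sub>L real)"
  assumes sep: "separable_space (euclidean :: 'b topology)"
    and M: "\<And>n. norm (f n) \<le> M"
  obtains r l where "strict_mono (r :: nat \<Rightarrow> nat)"
    "\<And>b. (\<lambda>n. blinfun_apply (f (r n)) b) \<longlonglongrightarrow> blinfun_apply l b"
proof -
  have M0: "0 \<le> M"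
    using M norm_ge_zero order_trans by blast
  have f_le: "\<bar>f n b\<bar> \<le> M * norm b" for n b
    using norm_blinfun[of "f n" b] M[of n] mult_right_mono[OF M norm_ge_zero]
    by (metis order_trans real_norm_def)
  obtain S :: "'b set" where S: "countable S" "closure S = UNIV"
    using sep by (auto simp: separable_space_def)
  \<comment> \<open>The diagonal lemma asks for one bound at all points, hence the division by \<open>1 + norm b\<close>.\<close>
  have "norm (f n b / (1 + norm b)) \<le> M" for n b
  proof -
    have "\<bar>f n b\<bar> \<le> M * (1 + norm b)"
      using f_le[of n b] M0 by (simp add: algebra_simps)
    then show ?thesis
      by (simp add: divide_le_eq add_pos_nonneg)
  qed
  then obtain r where r: "strict_mono (r :: nat \<Rightarrow> nat)"
    and "\<And>b. b \<in> S \<Longrightarrow> \<exists>l. (\<lambda>n. f (r n) b / (1 + norm b)) \<longlonglongrightarrow> l"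
    using function_convergent_subsequence[OF S(1), of "\<lambda>n b. f n b / (1 + norm b)" M] by metis
  moreover have "(\<lambda>n. f (r n) b) = (\<lambda>n. f (r n) b / (1 + norm b) * (1 + norm b))" for b
    by (auto simp: add_nonneg_eq_0_iff)
  ultimately have conv_S: "convergent (\<lambda>n. f (r n) b)" if "b \<in> S" for b
    by (metis convergentI convergent_mult_const_right_iff that tendsto_mult_right)
  have conv: "convergent (\<lambda>n. f (r n) b)" for b
  proof (subst Cauchy_convergent_iff[symmetric], rule metric_CauchyI)
    fix e :: real
    assume e: "e > 0"
    define d where "d = e / (3 * (M + 1))"
    have d: "d > 0" "M * d < e / 3"
      using e M0 by (auto simp: d_def field_simps)
    obtain s where s: "s \<in> S" "dist s b < d"
      using S(2) d(1) closure_approachable[of b S] by auto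
    have near: "\<bar>f n b - f n s\<bar> < e / 3" for n
    proof -
      have "\<bar>f n b - f n s\<bar> \<le> M * norm (b - s)"
        using f_le[of n "b - s"] by (simp add: blinfun.diff_right)
      also have "\<dots> \<le> M * d"
        using s(2) M0 by (intro mult_left_mono) (auto simp: dist_norm norm_minus_commute)
      finally show ?thesis
        using d(2) by linarith
    qed
    obtain N where N: "\<And>m n. m \<ge> N \<Longrightarrow> n \<ge> N \<Longrightarrow> dist (f (r m) s) (f (r n) s) < e / 3"
      using conv_S[OF s(1)] e unfolding Cauchy_convergent_iff[symmetric]
      by (metis Cauchy_def divide_pos_pos zero_less_numeral)
    have "dist (f (r m) b) (f (r n) b) < e" if "m \<ge> N" "n \<ge> N" for m n
      using N[OF that] near[of "r m"] near[of "r n"] unfolding dist_real_def by linarith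
    then show "\<exists>N. \<forall>m\<ge>N. \<forall>n\<ge>N. dist (f (r m) b) (f (r n) b) < e"
      by blast
  qed
  define g where "g b = lim (\<lambda>n. f (r n) b)" for b
  have g: "(\<lambda>n. f (r n) b) \<longlonglongrightarrow> g b" for b
    using conv[of b] by (simp add: g_def convergent_LIMSEQ_iff)
  have "bounded_linear g"
  proof (rule bounded_linear_intro[where K = M])
    fix x y :: 'b and c :: real
    show "g (x + y) = g x + g y"
      using g[of "x + y"] tendsto_add[OF g[of x] g[of y]]
      by (simp add: blinfun.add_right LIMSEQ_unique)
    show "g (c *\<^sub>R x) = c *\<^sub>R g x"
      using g[of "c *\<^sub>R x"] tendsto_scaleR[OF tendsto_const[of c] g[of x]]
      by (simp add: blinfun.scaleR_right LIMSEQ_unique)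
    show "norm (g x) \<le> norm x * M"
      using f_le by (intro Lim_bounded[OF tendsto_norm[OF g[of x]], of 0])
        (auto simp: mult.commute)
  qed
  then show ?thesis
    using that[of r "Blinfun g"] r g by (simp add: bounded_linear_Blinfun_apply)
qed

text \<open>
  The sequence is relatively weak-* compact, and zero is the only possible limit of a subsequence.
\<close>

lemma weak_star_null_if_strong_null_bounded:
  fixes pX :: "'w::real_normed_vector \<Rightarrow> 'x::banach"
    and J :: "'d::banach \<Rightarrow> ('b::banach \<Rightarrow>\<^sub>L real)"
  assumes spaces: "banach_intersection iX iD pX pD"
    and sep: "separable_space (euclidean :: 'b topology)"
    and J: "isometric_isomorphism J"
    and compatible: "\<And>(u :: nat \<Rightarrow> 'w) x d.
          weak_lim (\<lambda>i. pX (u i)) x \<Longrightarrow> weak_star_lim J (\<lambda>i. pD (u i)) d \<Longrightarrow> iX x = iD d"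
    and strong: "(\<lambda>i. pX (u i)) \<longlonglongrightarrow> 0"
    and bdd: "\<And>i. norm (pD (u i)) \<le> M"
  shows "weak_star_lim J (\<lambda>i. pD (u i)) 0"
  unfolding weak_star_lim_def
proof (rule allI, rule ccontr)
  interpret banach_intersection iX iD pX pD by (fact spaces)
  have J_linear: "linear J" and J_surj: "surj J" and J_norm: "\<And>d. norm (J d) = norm d"
    using J by (auto simp: isometric_isomorphism_def)
  fix b
  assume "\<not> (\<lambda>i. J (pD (u i)) b) \<longlonglongrightarrow> J 0 b"
  then obtain e where e: "e > 0" "\<not> (\<forall>\<^sub>F i in sequentially. \<bar>J (pD (u i)) b\<bar> < e)"
    by (auto simp: tendsto_iff linear_0[OF J_linear])
  have "\<not> finite {i. \<not> \<bar>J (pD (u i)) b\<bar> < e}"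
    using e(2) unfolding eventually_cofinite[symmetric] cofinite_eq_sequentially .
  then obtain q where q: "strict_mono (q :: nat \<Rightarrow> nat)" "\<And>n. \<not> \<bar>J (pD (u (q n))) b\<bar> < e"
    using infinite_enumerate by blast
  obtain r l where r: "strict_mono (r :: nat \<Rightarrow> nat)"
    and l: "\<And>c. (\<lambda>n. J (pD (u (q (r n)))) c) \<longlonglongrightarrow> blinfun_apply l c"
    using weak_star_convergent_subsequence[OF sep, of "\<lambda>n. J (pD (u (q n)))" M] bdd
    by (auto simp: J_norm)
  obtain d where d: "l = J d"
    using J_surj by (metis surjD)
  have "(\<lambda>n. pX (u (q (r n)))) \<longlonglongrightarrow> 0"
    using LIMSEQ_subseq_LIMSEQ[OF strong strict_mono_o[OF q(1) r]] by (simp add: o_def)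
  then have "weak_lim (\<lambda>n. pX (u (q (r n)))) 0"
    by (auto simp: weak_lim_def intro!: tendsto_eq_intros)
  then have "iX 0 = iD d"
    using compatible l d by (auto simp: weak_star_lim_def)
  then have "d = 0"
    using linear_0[OF linear_iX] linear_0[OF linear_iD] inj_iD by (metis injD)
  then have "(\<lambda>n. \<bar>J (pD (u (q (r n)))) b\<bar>) \<longlonglongrightarrow> 0"
    using tendsto_rabs[OF l[of b]] d by (simp add: linear_0[OF J_linear])
  then have "e \<le> 0"
    by (rule LIMSEQ_le_const) (use q(2) not_less in blast)
  then show False
    using e(1) by simp
qed

section \<open>A single step of the method\<close>

lemma form_norm_square:
  assumes "sym_pos_def_form A"
  shows "(form_norm A p)\<^sup>2 = A p p"
proof -
  have "bilinear A"
    using assms by (simp add: sym_pos_def_form_def)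
  then have "A p p \<ge> 0"
    using assms bilinear_lzero unfolding sym_pos_def_form_def by (metis less_eq_real_def)
  then show ?thesis
    by (simp add: form_norm_def)
qed

text \<open>
  First-order optimality condition of the subproblem: the difference quotient of the objective from
  the minimizer \<open>ybar\<close> towards \<open>\<eta>\<close> with step \<open>t\<close> is the left-hand side below plus
  \<open>t/2\<close> times \<open>A (\<eta> - ybar) (\<eta> - ybar)\<close>.
\<close>

lemma variational_inequality_of_minimizer:
  fixes A :: "'w::real_normed_vector \<Rightarrow> 'w \<Rightarrow> real" and l :: "'w \<Rightarrow>\<^sub>L real"
  assumes A: "sym_pos_def_form A"
    and min: "is_arg_min (\<lambda>y. 1/2 * (form_norm A (y - x))\<^sup>2 + c * blinfun_apply l (y - x))
      (\<lambda>y. y \<in> \<Phi>) ybar"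
    and conv: "convex \<Phi>" and \<eta>: "\<eta> \<in> \<Phi>"
  shows "A (ybar - x) (\<eta> - ybar) + c * blinfun_apply l (\<eta> - ybar) \<ge> 0"
proof -
  define v w where "v = ybar - x" and "w = \<eta> - ybar"
  have bil: "bilinear A" and sym: "\<And>p q. A p q = A q p"
    using A by (auto simp: sym_pos_def_form_def)
  note sq = form_norm_square[OF A]
  have ybar: "ybar \<in> \<Phi>"
    using min by (simp add: is_arg_min_def)
  have ineq: "0 \<le> A v w + c * l w + t / 2 * A w w" if t: "0 < t" "t \<le> 1" for t
  proof -
    have "ybar + t *\<^sub>R w = (1 - t) *\<^sub>R ybar + t *\<^sub>R \<eta>"
      by (simp add: w_def algebra_simps)
    then have "ybar + t *\<^sub>R w \<in> \<Phi>"
      using convexD_alt[OF conv ybar \<eta>] t by simp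
    moreover have "ybar + t *\<^sub>R w - x = v + t *\<^sub>R w"
      by (simp add: v_def)
    ultimately have "1/2 * A v v + c * l v \<le> 1/2 * A (v + t *\<^sub>R w) (v + t *\<^sub>R w) + c * l (v + t *\<^sub>R w)"
      using min unfolding is_arg_min_def sq v_def by (metis not_less)
    also have "A (v + t *\<^sub>R w) (v + t *\<^sub>R w) = A v v + 2 * t * A v w + t * t * A w w"
      using sym[of w v] by (simp add: bilinear_ladd[OF bil] bilinear_radd[OF bil]
          bilinear_lmul[OF bil] bilinear_rmul[OF bil] algebra_simps)
    finally have "0 \<le> t * (A v w + c * l w + t / 2 * A w w)"
      by (simp add: blinfun.add_right blinfun.scaleR_right algebra_simps)
    then show ?thesis
      using t by (simp add: zero_le_mult_iff)
  qed
  have "((\<lambda>t. A v w + c * l w + t / 2 * A w w) \<longlongrightarrow> A v w + c * l w) (at_right 0)"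
    by (auto intro!: tendsto_eq_intros)
  moreover have "\<forall>\<^sub>F t in at_right 0. 0 \<le> A v w + c * l w + t / 2 * A w w"
    using ineq by (auto simp: eventually_at_right_field intro!: exI[of _ 1])
  ultimately show ?thesis
    unfolding v_def w_def
    by (intro tendsto_lowerbound[of _ _ "at_right (0::real)"]) auto
qed

text \<open>
  By the mean value theorem the Armijo condition holds for every step length up to which the slope
  in direction \<open>x\<close> stays below the fraction \<open>\<sigma>\<close> of its initial value. Backtracking
  can therefore undershoot this length by a factor \<open>\<beta>\<close> at most.
\<close>

lemma armijo_step_lower_bound:
  fixes j :: "'w::real_normed_vector \<Rightarrow> real" and j' :: "'w \<Rightarrow> ('w \<Rightarrow>\<^sub>L real)"
  assumes deriv: "\<And>s. 0 \<le> s \<Longrightarrow> s \<le> 1 \<Longrightarrow>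
      (j has_derivative blinfun_apply (j' (p + s *\<^sub>R x))) (at (p + s *\<^sub>R x))"
    and slope: "\<And>s. 0 < s \<Longrightarrow> s \<le> 1 \<Longrightarrow> s \<le> \<tau> \<Longrightarrow>
      blinfun_apply (j' (p + s *\<^sub>R x) - j' p) x \<le> (1 - \<sigma>) * (- blinfun_apply (j' p) x)"
    and fails: "\<And>n. n < m \<Longrightarrow> \<not> armijo_cond j j' \<sigma> p x (\<beta> ^ n)"
    and \<beta>: "0 < \<beta>" "\<beta> < 1"
  shows "min 1 (\<beta> * \<tau>) \<le> \<beta> ^ m"
proof (cases m)
  case 0
  then show ?thesis by simp
next
  case (Suc n)
  define t where "t = \<beta> ^ n"
  have t: "0 < t" "t \<le> 1"
    using \<beta> by (auto simp: t_def power_le_one)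
  have "\<tau> < t"
  proof (rule ccontr)
    assume "\<not> \<tau> < t"
    have d: "((\<lambda>s. j (p + s *\<^sub>R x)) has_derivative (\<lambda>h. h * j' (p + s *\<^sub>R x) x)) (at s within {0..t})"
      if "0 \<le> s" "s \<le> t" for s
    proof -
      have "((\<lambda>s. p + s *\<^sub>R x) has_derivative (\<lambda>h. h *\<^sub>R x)) (at s within {0..t})"
        by (auto intro!: derivative_eq_intros)
      moreover have "(j has_derivative blinfun_apply (j' (p + s *\<^sub>R x))) (at (p + s *\<^sub>R x))"
        using that t deriv by simp
      ultimately show ?thesis
        by (rule has_derivative_compose[THEN has_derivative_eq_rhs]) (simp add: blinfun.scaleR_right)
    qed
    obtain s where s: "s \<in> {0<..<t}" "j (p + t *\<^sub>R x) - j (p + 0 *\<^sub>R x) = (t - 0) * j' (p + s *\<^sub>R x) x"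
      using mvt_simple[OF t(1) d] by blast
    have "j' (p + s *\<^sub>R x) x \<le> \<sigma> * j' p x"
      using slope[of s] s(1) t \<open>\<not> \<tau> < t\<close> by (simp add: blinfun.diff_left algebra_simps)
    then have "t * j' (p + s *\<^sub>R x) x \<le> t * (\<sigma> * j' p x)"
      using t by (intro mult_left_mono) auto
    then have "armijo_cond j j' \<sigma> p x t"
      using s(2) by (simp add: armijo_cond_def)
    then show False
      using fails[of n] Suc by (simp add: t_def)
  qed
  then show ?thesis
    using \<beta> Suc by (auto simp: t_def min_le_iff_disj intro!: disjI2 mult_left_mono)
qed

section \<open>Convergence along a run\<close>

text \<open>
  A run together with the constants that occur in the estimates. Weak and weak-*
  convergence enter only through the cross terms in \<open>limit_stationary\<close>.
\<close>

locale vmpt_iterates = banach_intersection iX iD pX pD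
  for iX :: "'x::banach \<Rightarrow> 'v::real_vector"
    and iD :: "'d::banach \<Rightarrow> 'v"
    and pX :: "'w::real_normed_vector \<Rightarrow> 'x"
    and pD :: "'w \<Rightarrow> 'd" +
  fixes \<Phi> :: "'w set" and U :: "'w set"
    and j :: "'w \<Rightarrow> real" and j' :: "'w \<Rightarrow> ('w \<Rightarrow>\<^sub>L real)"
    and a :: "nat \<Rightarrow> 'w \<Rightarrow> 'w \<Rightarrow> real" and lam :: "nat \<Rightarrow> real"
    and \<beta> \<sigma> M C c lmin lmax :: real
    and \<phi> v :: "nat \<Rightarrow> 'w"
  assumes convex: "convex \<Phi>" and closed: "closed (pX ` \<Phi>)"
    and D_bound: "p \<in> \<Phi> \<Longrightarrow> norm (pD p) \<le> M"
    and j_bound: "p \<in> \<Phi> \<Longrightarrow> j p \<ge> - C"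
    and open_U: "open U" and \<Phi>_U: "\<Phi> \<subseteq> U"
    and deriv: "p \<in> U \<Longrightarrow> (j has_derivative blinfun_apply (j' p)) (at p)"
    and cont: "continuous_on U j'"
    and form: "sym_pos_def_form (a k)"
    and c: "c > 0" and coercive: "c * (norm (pX p))\<^sup>2 \<le> (form_norm (a k) p)\<^sup>2"
    and lmin: "lmin > 0" "lmin \<le> lam k" and lmax: "lam k \<le> lmax"
    and \<beta>: "0 < \<beta>" "\<beta> < 1" and \<sigma>: "0 < \<sigma>" "\<sigma> < 1"
    and run: "vmpt_run pX \<Phi> j j' \<beta> \<sigma> 0 a lam \<phi> v"
begin

lemma step_cases:
  obtains m where
    "is_arg_min (\<lambda>y. 1/2 * (form_norm (a k) (y - \<phi> k))\<^sup>2 + lam k * blinfun_apply (j' (\<phi> k)) (y - \<phi> k))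
      (\<lambda>y. y \<in> \<Phi>) (\<phi> k + v k)"
    "armijo_cond j j' \<sigma> (\<phi> k) (v k) (\<beta> ^ m)"
    "\<And>n. n < m \<Longrightarrow> \<not> armijo_cond j j' \<sigma> (\<phi> k) (v k) (\<beta> ^ n)"
    "\<phi> (Suc k) = \<phi> k + \<beta> ^ m *\<^sub>R v k"
proof -
  have "vmpt_step pX \<Phi> j j' \<beta> \<sigma> 0 (a k) (lam k) (\<phi> k) (v k) (\<phi> (Suc k))"
    using run by (simp add: vmpt_run_def)
  then obtain ybar m where m:
    "is_arg_min (\<lambda>y. 1/2 * (form_norm (a k) (y - \<phi> k))\<^sup>2 + lam k * blinfun_apply (j' (\<phi> k)) (y - \<phi> k))
      (\<lambda>y. y \<in> \<Phi>) ybar"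
    "v k = ybar - \<phi> k" "armijo_cond j j' \<sigma> (\<phi> k) (v k) (\<beta> ^ m)"
    "\<forall>n<m. \<not> armijo_cond j j' \<sigma> (\<phi> k) (v k) (\<beta> ^ n)" "\<phi> (Suc k) = \<phi> k + \<beta> ^ m *\<^sub>R v k"
    unfolding vmpt_step_def by blast
  moreover have "ybar = \<phi> k + v k"
    using m(2) by simp
  ultimately show ?thesis
    using that by blast
qed

lemma target_in: "\<phi> k + v k \<in> \<Phi>"
  by (rule step_cases[of k]) (simp add: is_arg_min_def)

lemma segment_in:
  assumes "\<phi> k \<in> \<Phi>" "0 \<le> s" "s \<le> 1"
  shows "\<phi> k + s *\<^sub>R v k \<in> \<Phi>"
proof -
  have "\<phi> k + s *\<^sub>R v k = (1 - s) *\<^sub>R \<phi> k + s *\<^sub>R (\<phi> k + v k)"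
    by (simp add: algebra_simps)
  then show ?thesis
    using convexD_alt[OF convex assms(1) target_in] assms by simp
qed

lemma iterate_in: "\<phi> k \<in> \<Phi>"
proof (induction k)
  case 0
  then show ?case
    using run by (simp add: vmpt_run_def)
next
  case (Suc k)
  obtain m where "\<phi> (Suc k) = \<phi> k + \<beta> ^ m *\<^sub>R v k"
    using step_cases[of k] by blast
  then show ?case
    using segment_in[OF Suc, of "\<beta> ^ m"] \<beta> by (simp add: power_le_one)
qed

definition descent :: "nat \<Rightarrow> real" where
  "descent k = - blinfun_apply (j' (\<phi> k)) (v k)"

lemma variational_inequality:
  assumes "\<eta> \<in> \<Phi>"
  shows "0 \<le> a k (v k) (\<eta> - \<phi> k) - a k (v k) (v k)
    + lam k * (blinfun_apply (j' (\<phi> k)) (\<eta> - \<phi> k) + descent k)"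
proof -
  have bil: "bilinear (a k)"
    using form by (simp add: sym_pos_def_form_def)
  have w: "\<eta> - (\<phi> k + v k) = (\<eta> - \<phi> k) - v k"
    by simp
  obtain m where "is_arg_min (\<lambda>y. 1/2 * (form_norm (a k) (y - \<phi> k))\<^sup>2
      + lam k * blinfun_apply (j' (\<phi> k)) (y - \<phi> k)) (\<lambda>y. y \<in> \<Phi>) (\<phi> k + v k)"
    using step_cases[of k] by blast
  from variational_inequality_of_minimizer[OF form this convex assms] show ?thesis
    unfolding w by (simp add: bilinear_rsub[OF bil] blinfun.diff_right descent_def)
qed

lemma form_nonneg: "0 \<le> a k p p"
  using form_norm_square[OF form[of k], of p] by (metis zero_le_power2)

lemma lmax_pos: "lmax > 0"
  using lmin(1) lmin(2)[of 0] lmax[of 0] by linarith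

text \<open>
  Testing the variational inequality with the current iterate gives
  \<open>a k (v k) (v k) \<le> lam k * descent k\<close>.
\<close>

lemma descent_bound:
  shows "0 \<le> descent k" and "c * (norm (pX (v k)))\<^sup>2 \<le> lmax * descent k"
proof -
  have bil: "bilinear (a k)"
    using form by (simp add: sym_pos_def_form_def)
  have *: "a k (v k) (v k) \<le> lam k * descent k"
    using variational_inequality[OF iterate_in, of k k] bilinear_rzero[OF bil]
    by (simp add: blinfun.zero_right)
  have l: "0 < lam k"
    using lmin(1) lmin(2)[of k] by linarith
  then show nn: "0 \<le> descent k"
    using * form_nonneg[of k "v k"] by (metis order_trans zero_le_mult_iff not_less)
  have "c * (norm (pX (v k)))\<^sup>2 \<le> lam k * descent k"
    using coercive[of "v k" k] * form_norm_square[OF form[of k], of "v k"] by linarith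
  also have "\<dots> \<le> lmax * descent k"
    using lmax nn by (rule mult_right_mono)
  finally show "c * (norm (pX (v k)))\<^sup>2 \<le> lmax * descent k" .
qed

lemma D_norm_direction_le: "norm (pD (v k)) \<le> 2 * M"
proof -
  have "pD (v k) = pD (\<phi> k + v k) - pD (\<phi> k)"
    by (simp add: linear_add[OF linear_pD])
  then have "norm (pD (v k)) \<le> norm (pD (\<phi> k + v k)) + norm (pD (\<phi> k))"
    by (metis norm_triangle_ineq4)
  then show ?thesis
    using D_bound[OF target_in[of k]] D_bound[OF iterate_in[of k]] by linarith
qed

lemma norm_direction_le: "norm (v k) \<le> norm (pX (v k)) + 2 * M"
  using D_norm_direction_le[of k] by (simp add: norm_sum)

lemma M_nonneg: "0 \<le> M"
  using D_bound[OF iterate_in[of 0]] norm_ge_zero order_trans by blast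

text \<open>
  Control of the slope up to the length \<open>\<tau>\<close> turns the Armijo condition into a decrease of \<open>j\<close> that
  no longer mentions the accepted step length.
\<close>

lemma decrease:
  assumes \<tau>: "0 \<le> \<tau>"
    and slope: "\<And>s. 0 < s \<Longrightarrow> s \<le> 1 \<Longrightarrow> s \<le> \<tau> \<Longrightarrow>
      blinfun_apply (j' (\<phi> k + s *\<^sub>R v k) - j' (\<phi> k)) (v k) \<le> (1 - \<sigma>) * descent k"
  shows "\<sigma> * min 1 (\<beta> * \<tau>) * descent k \<le> j (\<phi> k) - j (\<phi> (Suc k))"
proof -
  obtain m where m: "armijo_cond j j' \<sigma> (\<phi> k) (v k) (\<beta> ^ m)"
    "\<And>n. n < m \<Longrightarrow> \<not> armijo_cond j j' \<sigma> (\<phi> k) (v k) (\<beta> ^ n)"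
    "\<phi> (Suc k) = \<phi> k + \<beta> ^ m *\<^sub>R v k"
    using step_cases[of k] by metis
  have "min 1 (\<beta> * \<tau>) \<le> \<beta> ^ m"
    using slope \<Phi>_U segment_in[OF iterate_in, of _ k] unfolding descent_def
    by (intro armijo_step_lower_bound[where j' = j', OF _ _ m(2) \<beta>]) (auto intro!: deriv)
  then have "min 1 (\<beta> * \<tau>) * (\<sigma> * descent k) \<le> \<beta> ^ m * (\<sigma> * descent k)"
    using descent_bound(1)[of k] \<sigma> by (intro mult_right_mono) auto
  then show ?thesis
    using m(1,3) by (simp add: armijo_cond_def descent_def mult_ac)
qed

lemma values_converge: "convergent (\<lambda>k. j (\<phi> k))"
proof -
  have "j (\<phi> (Suc k)) \<le> j (\<phi> k)" for k
    \<comment> \<open>For \<open>\<tau> = 0\<close> the slope condition of \<open>decrease\<close> is vacuous.\<close>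
    using decrease[of 0 k] by simp
  then have "decseq (\<lambda>k. j (\<phi> k))"
    by (rule decseq_SucI)
  then show ?thesis
    by (rule decseq_convergent[of _ "- C"]) (auto intro: convergentI j_bound iterate_in)
qed

text \<open>
  Steps from which backtracking is under control and which offer a definite descent would each
  decrease \<open>j\<close> by a fixed amount, so only finitely many of them occur.
\<close>

lemma eventually_not_controlled:
  assumes \<tau>: "0 < \<tau>" and \<epsilon>: "0 < \<epsilon>"
    and large: "\<And>k. P k \<Longrightarrow> \<epsilon> \<le> descent k"
    and slope: "\<And>k s. P k \<Longrightarrow> 0 < s \<Longrightarrow> s \<le> 1 \<Longrightarrow> s \<le> \<tau> \<Longrightarrow>
      blinfun_apply (j' (\<phi> k + s *\<^sub>R v k) - j' (\<phi> k)) (v k) \<le> (1 - \<sigma>) * descent k"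
  shows "\<forall>\<^sub>F k in sequentially. \<not> P k"
proof -
  define \<kappa> where "\<kappa> = \<sigma> * min 1 (\<beta> * \<tau>)"
  have \<kappa>: "0 < \<kappa>"
    using \<sigma> \<beta> \<tau> by (simp add: \<kappa>_def)
  obtain l where l: "(\<lambda>k. j (\<phi> k)) \<longlonglongrightarrow> l"
    using values_converge by (auto simp: convergent_def)
  have "(\<lambda>k. j (\<phi> k) - j (\<phi> (Suc k))) \<longlonglongrightarrow> 0"
    using tendsto_diff[OF l LIMSEQ_Suc[OF l]] by simp
  then have "\<forall>\<^sub>F k in sequentially. j (\<phi> k) - j (\<phi> (Suc k)) < \<kappa> * \<epsilon>"
    using \<kappa> \<epsilon> by (intro order_tendstoD) auto
  then show ?thesis
  proof eventually_elim
    case (elim k)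
    show ?case
    proof
      assume P: "P k"
      have "\<kappa> * \<epsilon> \<le> \<kappa> * descent k"
        using large[OF P] \<kappa> by (intro mult_left_mono) auto
      also have "\<dots> \<le> j (\<phi> k) - j (\<phi> (Suc k))"
        using decrease[OF less_imp_le[OF \<tau>] slope[OF P]] by (simp add: \<kappa>_def)
      finally show False
        using elim by simp
    qed
  qed
qed

text \<open>
  Convergence in the intersection implies convergence in \<open>'x\<close>, where the image of \<open>\<Phi>\<close>
  is closed, and an element of the intersection is determined by its image in \<open>'x\<close>.
\<close>

lemma limit_in:
  assumes "(\<phi> \<circ> r) \<longlonglongrightarrow> p"
  shows "p \<in> \<Phi>"
proof -
  have "bounded_linear pX"
    using linear_pX by (intro bounded_linear_intro[of _ 1])
      (auto simp: linear_add linear_scale norm_sum)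
  then have "(\<lambda>i. pX (\<phi> (r i))) \<longlonglongrightarrow> pX p"
    using assms by (auto intro: bounded_linear.tendsto simp: o_def)
  then have "pX p \<in> pX ` \<Phi>"
    by (rule closed_sequentially[OF closed, of "\<lambda>i. pX (\<phi> (r i))", rotated]) (use iterate_in in auto)
  then obtain q where q: "q \<in> \<Phi>" "pX p = pX q"
    by auto
  then have "pD p = pD q"
    using same_vector[of p] same_vector[of q] inj_iD by (metis injD)
  then have "norm (p - q) = 0"
    using q(2) by (simp add: norm_sum linear_diff[OF linear_pX] linear_diff[OF linear_pD])
  then show ?thesis
    using q(1) by simp
qed

lemma derivative_continuous_at:
  assumes "p \<in> \<Phi>"
  shows "isCont j' p"
  using assms cont open_U \<Phi>_U continuous_on_eq_continuous_at by blast

text \<open>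
  The square of the \<open>'x\<close>-norm of \<open>v k\<close> is bounded linearly by the norm of \<open>v k\<close> as long as
  \<open>j'\<close> stays bounded, and the \<open>'d\<close>-part of \<open>v k\<close> is bounded because \<open>\<Phi>\<close> is.
\<close>

lemma directions_bounded:
  assumes r: "(\<phi> \<circ> r) \<longlonglongrightarrow> p"
  obtains K where "0 < K" "\<forall>\<^sub>F i in sequentially. norm (v (r i)) \<le> K"
proof -
  define N where "N = norm (j' p) + 1"
  define K where "K = max 1 (lmax * N * (1 + 2 * M) / c) + 2 * M"
  have "(\<lambda>i. norm (j' (\<phi> (r i)))) \<longlonglongrightarrow> norm (j' p)"
    using isCont_tendsto_compose[OF derivative_continuous_at[OF limit_in[OF r]] r]
    by (intro tendsto_norm) (simp add: o_def)
  then have "\<forall>\<^sub>F i in sequentially. norm (j' (\<phi> (r i))) < N"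
    by (rule order_tendstoD) (simp add: N_def)
  then have "\<forall>\<^sub>F i in sequentially. norm (v (r i)) \<le> K"
  proof eventually_elim
    case (elim i)
    define x where "x = norm (pX (v (r i)))"
    have N: "0 < N"
      unfolding N_def using norm_ge_zero[of "j' p"] by linarith
    have "x \<le> max 1 (lmax * N * (1 + 2 * M) / c)"
    proof (cases "x \<le> 1")
      case False
      have "descent (r i) \<le> norm (j' (\<phi> (r i))) * norm (v (r i))"
        using norm_blinfun[of "j' (\<phi> (r i))" "v (r i)"] by (simp add: descent_def)
      also have "\<dots> \<le> N * (x + 2 * M)"
        using elim norm_direction_le N by (intro mult_mono) (auto simp: x_def)
      also have "\<dots> \<le> N * (x * (1 + 2 * M))"
        using False N M_nonneg mult_right_mono[of 1 x M]
        by (intro mult_left_mono) (auto simp: algebra_simps)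
      finally have "lmax * descent (r i) \<le> lmax * (N * (x * (1 + 2 * M)))"
        using lmax_pos by (intro mult_left_mono) auto
      then have "x * (c * x) \<le> x * (lmax * N * (1 + 2 * M))"
        using descent_bound(2)[of "r i"] by (simp add: x_def power2_eq_square mult_ac)
      then have "x * c \<le> lmax * N * (1 + 2 * M)"
        using False by (simp add: mult_ac)
      then show ?thesis
        using c by (simp add: le_max_iff_disj pos_le_divide_eq)
    qed simp
    then show ?case
      using norm_direction_le[of "r i"] by (simp add: K_def x_def)
  qed
  moreover have "0 < K"
    using M_nonneg by (simp add: K_def)
  ultimately show ?thesis
    using that by blast
qed

text \<open>
  Near the limit the continuity of \<open>j'\<close> keeps the slope along all steps of a fixed length
  under control, because the directions are bounded.
\<close>

lemma descent_null:
  assumes r: "strict_mono r" "(\<phi> \<circ> r) \<longlonglongrightarrow> p"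
  shows "(\<lambda>i. descent (r i)) \<longlonglongrightarrow> 0"
proof (rule tendstoI)
  fix \<epsilon> :: real
  assume \<epsilon>: "0 < \<epsilon>"
  obtain K where K: "0 < K" "\<forall>\<^sub>F i in sequentially. norm (v (r i)) \<le> K"
    using directions_bounded[OF r(2)] by blast
  \<comment> \<open>Two derivatives, each within \<open>\<theta>\<close> of the limit, differ on a vector of norm at most \<open>K\<close> by
    at most \<open>2 * \<theta> * K\<close>, which is the admissible change of slope.\<close>
  define \<theta> where "\<theta> = (1 - \<sigma>) * \<epsilon> / (2 * K)"
  have \<theta>: "0 < \<theta>" "2 * \<theta> * K = (1 - \<sigma>) * \<epsilon>"
    using \<epsilon> K \<sigma> by (auto simp: \<theta>_def)
  obtain d where d: "0 < d" "\<And>q. dist q p < d \<Longrightarrow> dist (j' q) (j' p) < \<theta>"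
    using derivative_continuous_at[OF limit_in[OF r(2)]] \<theta>(1)
    unfolding continuous_at_eps_delta by blast
  define P where "P k \<longleftrightarrow> dist (\<phi> k) p < d / 2 \<and> norm (v k) \<le> K \<and> \<epsilon> \<le> descent k" for k
  have "\<forall>\<^sub>F k in sequentially. \<not> P k"
  proof (rule eventually_not_controlled[where \<tau> = "d / (2 * K)" and \<epsilon> = \<epsilon>])
    fix k s
    assume P: "P k" and s: "0 < s" "s \<le> 1" "s \<le> d / (2 * K)"
    let ?q = "\<phi> k + s *\<^sub>R v k"
    have "s * norm (v k) \<le> d / (2 * K) * K"
      using P s K by (intro mult_mono) (auto simp: P_def)
    then have "dist ?q (\<phi> k) \<le> d / 2"
      using K s by (simp add: dist_norm)
    then have "dist ?q p < d"
      using P dist_triangle[of ?q p "\<phi> k"] by (simp add: P_def)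
    moreover have "dist (\<phi> k) p < d"
      using P d(1) by (simp add: P_def)
    ultimately have "dist (j' ?q) (j' (\<phi> k)) \<le> 2 * \<theta>"
      using d(2)[of ?q] d(2)[of "\<phi> k"] dist_triangle2[of "j' ?q" "j' (\<phi> k)" "j' p"] by linarith
    then have "norm (j' ?q - j' (\<phi> k)) * norm (v k) \<le> 2 * \<theta> * K"
      using P \<theta> by (intro mult_mono) (auto simp: P_def dist_norm)
    then have "blinfun_apply (j' ?q - j' (\<phi> k)) (v k) \<le> (1 - \<sigma>) * \<epsilon>"
      using norm_blinfun[of "j' ?q - j' (\<phi> k)" "v k"] \<theta>(2) by simp
    also have "\<dots> \<le> (1 - \<sigma>) * descent k"
      using P \<sigma> by (intro mult_left_mono) (auto simp: P_def)
    finally show "blinfun_apply (j' ?q - j' (\<phi> k)) (v k) \<le> (1 - \<sigma>) * descent k" .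
  qed (use d K \<epsilon> in \<open>auto simp: P_def\<close>)
  then have "\<forall>\<^sub>F i in sequentially. \<not> P (r i)"
    by (rule eventually_subseq[OF r(1)])
  moreover have "\<forall>\<^sub>F i in sequentially. dist (\<phi> (r i)) p < d / 2"
    using tendstoD[OF r(2), of "d / 2"] d(1) by simp
  ultimately show "\<forall>\<^sub>F i in sequentially. dist (descent (r i)) 0 < \<epsilon>"
    using K(2) by eventually_elim (use descent_bound(1) in \<open>auto simp: P_def\<close>)
qed

lemma direction_null:
  assumes "strict_mono r" "(\<phi> \<circ> r) \<longlonglongrightarrow> p"
  shows "(\<lambda>i. pX (v (r i))) \<longlonglongrightarrow> 0"
proof -
  have "(\<lambda>i. lmax / c * descent (r i)) \<longlonglongrightarrow> 0"
    using tendsto_mult_left[OF descent_null[OF assms], of "lmax / c"] by simp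
  moreover have "(norm (pX (v (r i))))\<^sup>2 \<le> lmax / c * descent (r i)" for i
    using descent_bound(2)[of "r i"] c by (simp add: pos_le_divide_eq mult.commute)
  ultimately have "(\<lambda>i. (norm (pX (v (r i))))\<^sup>2) \<longlonglongrightarrow> 0"
    using tendsto_sandwich[of "\<lambda>_. 0" "\<lambda>i. (norm (pX (v (r i))))\<^sup>2" sequentially
        "\<lambda>i. lmax / c * descent (r i)" 0] by simp
  then have "(\<lambda>i. sqrt ((norm (pX (v (r i))))\<^sup>2)) \<longlonglongrightarrow> sqrt 0"
    by (rule tendsto_real_sqrt)
  then show ?thesis
    by (simp add: tendsto_norm_zero_iff)
qed

text \<open>
  The terms \<open>a k (v k) (v k)\<close> have a favourable sign in the variational inequality, so only the
  cross terms and the descent need to vanish.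
\<close>

lemma limit_stationary:
  assumes r: "strict_mono r" "(\<phi> \<circ> r) \<longlonglongrightarrow> p"
    and cross: "\<And>\<eta>. \<eta> \<in> \<Phi> \<Longrightarrow> (\<lambda>i. a (r i) (v (r i)) (\<eta> - \<phi> (r i))) \<longlonglongrightarrow> 0"
  shows "stationary_point \<Phi> j' p"
  unfolding stationary_point_def
proof (intro conjI ballI)
  show p: "p \<in> \<Phi>"
    by (rule limit_in[OF r(2)])
  fix \<eta>
  assume \<eta>: "\<eta> \<in> \<Phi>"
  let ?x = "\<lambda>i. a (r i) (v (r i)) (\<eta> - \<phi> (r i))"
  have "- (\<bar>?x i\<bar> / lmin) - descent (r i) \<le> j' (\<phi> (r i)) (\<eta> - \<phi> (r i))" for i
  proof -
    define y where "y = j' (\<phi> (r i)) (\<eta> - \<phi> (r i)) + descent (r i)"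
    have l: "0 < lam (r i)"
      using lmin(1) lmin(2)[of "r i"] by linarith
    have "0 \<le> \<bar>?x i\<bar> + lam (r i) * y"
      using variational_inequality[OF \<eta>, of "r i"] form_nonneg[of "r i" "v (r i)"]
      unfolding y_def by linarith
    then have "0 \<le> (\<bar>?x i\<bar> + lam (r i) * y) / lam (r i)"
      using l by simp
    then have "- (\<bar>?x i\<bar> / lam (r i)) \<le> y"
      using l by (simp add: add_divide_distrib)
    moreover have "\<bar>?x i\<bar> / lam (r i) \<le> \<bar>?x i\<bar> / lmin"
      using lmin l by (intro divide_left_mono) auto
    ultimately show ?thesis
      by (simp add: y_def)
  qed
  moreover have "(\<lambda>i. - (\<bar>?x i\<bar> / lmin) - descent (r i)) \<longlonglongrightarrow> 0"
    using cross[OF \<eta>] descent_null[OF r] lmin(1)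
    by (auto intro!: tendsto_eq_intros)
  moreover have "(\<lambda>i. j' (\<phi> (r i)) (\<eta> - \<phi> (r i))) \<longlonglongrightarrow> j' p (\<eta> - p)"
    using isCont_tendsto_compose[OF derivative_continuous_at[OF p] r(2)] r(2)
    by (intro blinfun.tendsto tendsto_intros) (auto simp: o_def)
  ultimately show "0 \<le> j' p (\<eta> - p)"
    using LIMSEQ_le by blast
qed

text \<open>
  While the \<open>'x\<close>-norm \<open>x\<close> of \<open>v k\<close> is at least \<open>\<epsilon>\<close>, it dominates the full norm up to a constant
  factor. Hoelder continuity then bounds the change of slope at step length \<open>s\<close> by a multiple of
  \<open>s powr \<gamma> * x powr (1 + \<gamma>)\<close>, and since \<open>\<gamma> \<le> 1\<close> this is small against the quadratic lower bound of
  the descent as soon as \<open>s\<close> is small, uniformly in \<open>k\<close>.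
\<close>

lemma all_directions_null:
  assumes \<gamma>: "0 < \<gamma>" "\<gamma> \<le> 1" and L: "0 \<le> L"
    and hoelder: "\<And>p q. p \<in> \<Phi> \<Longrightarrow> q \<in> \<Phi> \<Longrightarrow> norm (j' p - j' q) \<le> L * norm (p - q) powr \<gamma>"
  shows "(\<lambda>k. pX (v k)) \<longlonglongrightarrow> 0"
proof (rule tendstoI)
  fix \<epsilon> :: real
  assume \<epsilon>: "0 < \<epsilon>"
  define K where "K = 1 + 2 * M / \<epsilon>"
  define A where "A = L * K powr (1 + \<gamma>) * \<epsilon> powr (\<gamma> - 1)"
  \<comment> \<open>\<open>A * s powr \<gamma> * x\<^sup>2\<close> bounds the change of slope, and \<open>s powr \<gamma> \<le> B\<close> keeps it below \<open>1 - \<sigma>\<close>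
    times the lower bound \<open>c / lmax * x\<^sup>2\<close> of the descent; \<open>A + 1\<close> avoids a division by zero.\<close>
  define B where "B = (1 - \<sigma>) * (c / lmax) / (A + 1)"
  have K: "1 \<le> K"
    using M_nonneg \<epsilon> by (simp add: K_def)
  have A: "0 \<le> A"
    using L by (simp add: A_def)
  have B: "0 < B" "A * B \<le> (1 - \<sigma>) * (c / lmax)"
  proof -
    have "A / (A + 1) \<le> 1"
      using A by simp
    then have "(1 - \<sigma>) * (c / lmax) * (A / (A + 1)) \<le> (1 - \<sigma>) * (c / lmax)"
      using \<sigma> c lmax_pos by (intro mult_left_le) auto
    moreover have "A * B = (1 - \<sigma>) * (c / lmax) * (A / (A + 1))"
      by (simp add: B_def)
    ultimately show "A * B \<le> (1 - \<sigma>) * (c / lmax)"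
      by simp
    show "0 < B"
      using A \<sigma> c lmax_pos by (simp add: B_def)
  qed
  have quadratic: "c / lmax * (norm (pX (v k)))\<^sup>2 \<le> descent k" for k
    using descent_bound(2)[of k] lmax_pos by (simp add: pos_divide_le_eq mult.commute)
  have "\<forall>\<^sub>F k in sequentially. \<not> \<epsilon> \<le> norm (pX (v k))"
  proof (rule eventually_not_controlled[where \<tau> = "B powr (1 / \<gamma>)" and \<epsilon> = "c / lmax * \<epsilon>\<^sup>2"])
    fix k
    assume "\<epsilon> \<le> norm (pX (v k))"
    then have "c / lmax * \<epsilon>\<^sup>2 \<le> c / lmax * (norm (pX (v k)))\<^sup>2"
      using \<epsilon> c lmax_pos by (intro mult_left_mono power_mono) auto
    then show "c / lmax * \<epsilon>\<^sup>2 \<le> descent k"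
      using quadratic[of k] by linarith
  next
    fix k s
    define x where "x = norm (pX (v k))"
    assume "\<epsilon> \<le> norm (pX (v k))" and s: "0 < s" "s \<le> 1" "s \<le> B powr (1 / \<gamma>)"
    then have x: "\<epsilon> \<le> x" "0 < x"
      using \<epsilon> by (auto simp: x_def)
    have "2 * M = 2 * M / \<epsilon> * \<epsilon>"
      using \<epsilon> by simp
    also have "\<dots> \<le> 2 * M / \<epsilon> * x"
      using x M_nonneg \<epsilon> by (intro mult_left_mono) auto
    finally have v: "norm (v k) \<le> K * x"
      using norm_direction_le[of k] by (simp add: K_def x_def algebra_simps)
    have "s powr \<gamma> \<le> (B powr (1 / \<gamma>)) powr \<gamma>"
      using s \<gamma> by (intro powr_mono2) auto
    then have sB: "s powr \<gamma> \<le> B"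
      using \<gamma> B by (simp add: powr_powr)
    have "x powr (1 + \<gamma>) = x powr (\<gamma> - 1) * x\<^sup>2"
      using x by (simp add: powr_add[symmetric] flip: powr_numeral)
    also have "\<dots> \<le> \<epsilon> powr (\<gamma> - 1) * x\<^sup>2"
      using x \<epsilon> \<gamma> by (intro mult_right_mono powr_mono2') auto
    finally have xx: "x powr (1 + \<gamma>) \<le> \<epsilon> powr (\<gamma> - 1) * x\<^sup>2" .
    have "blinfun_apply (j' (\<phi> k + s *\<^sub>R v k) - j' (\<phi> k)) (v k)
        \<le> norm (j' (\<phi> k + s *\<^sub>R v k) - j' (\<phi> k)) * norm (v k)"
      using norm_blinfun[of "j' (\<phi> k + s *\<^sub>R v k) - j' (\<phi> k)" "v k"] by simp
    also have "\<dots> \<le> L * norm (s *\<^sub>R v k) powr \<gamma> * norm (v k)"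
      using hoelder[OF segment_in[OF iterate_in, of s k] iterate_in[of k]] s
      by (intro mult_right_mono) auto
    also have "\<dots> = L * s powr \<gamma> * (norm (v k) powr \<gamma> * norm (v k))"
      using s by (simp add: powr_mult)
    also have "\<dots> = L * s powr \<gamma> * norm (v k) powr (1 + \<gamma>)"
      by (cases "v k = 0") (simp_all add: powr_add)
    also have "\<dots> \<le> L * B * (K * x) powr (1 + \<gamma>)"
      using sB v L \<gamma> B by (intro mult_mono powr_mono2) auto
    also have "\<dots> = L * B * K powr (1 + \<gamma>) * x powr (1 + \<gamma>)"
      using K x by (simp add: powr_mult)
    also have "\<dots> \<le> L * B * K powr (1 + \<gamma>) * (\<epsilon> powr (\<gamma> - 1) * x\<^sup>2)"
      using xx L B by (intro mult_left_mono) auto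
    also have "\<dots> = A * B * x\<^sup>2"
      by (simp add: A_def)
    also have "\<dots> \<le> (1 - \<sigma>) * (c / lmax) * x\<^sup>2"
      using B by (intro mult_right_mono) auto
    also have "\<dots> \<le> (1 - \<sigma>) * descent k"
      using mult_left_mono[OF quadratic[of k], of "1 - \<sigma>"] \<sigma>
      by (simp add: x_def mult.assoc del: times_divide_eq_left times_divide_eq_right)
    finally show "blinfun_apply (j' (\<phi> k + s *\<^sub>R v k) - j' (\<phi> k)) (v k) \<le> (1 - \<sigma>) * descent k" .
  qed (use \<epsilon> c lmax_pos B in auto)
  then show "\<forall>\<^sub>F k in sequentially. dist (pX (v k)) 0 < \<epsilon>"
    by (simp add: not_le)
qed

end

theorem theorem2p2:
  fixes iX :: "'x::banach \<Rightarrow> 'v::real_vector"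
    and iD :: "'d::banach \<Rightarrow> 'v"
    and pX :: "'w::real_normed_vector \<Rightarrow> 'x"
    and pD :: "'w \<Rightarrow> 'd"
    and J :: "'d \<Rightarrow> ('b::banach \<Rightarrow>\<^sub>L real)"
    and \<Phi> :: "'w set"
    and j :: "'w \<Rightarrow> real"
    and j' :: "'w \<Rightarrow> ('w \<Rightarrow>\<^sub>L real)"
    and a :: "nat \<Rightarrow> 'w \<Rightarrow> 'w \<Rightarrow> real"
    and lam :: "nat \<Rightarrow> real"
    and \<beta> \<sigma> :: real
    and \<phi> v :: "nat \<Rightarrow> 'w"
  assumes spaces: "banach_intersection iX iD pX pD"
    and A1_reflexive: "reflexive_space TYPE('x)"
    and A1_dual: "separable_space (euclidean :: 'b topology)" "isometric_isomorphism J"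
    and A1_compatible: "\<And>(u :: nat \<Rightarrow> 'w) x d.
          weak_lim (\<lambda>i. pX (u i)) x \<Longrightarrow> weak_star_lim J (\<lambda>i. pD (u i)) d \<Longrightarrow> iX x = iD d"
    and A2: "convex \<Phi>" "closed (pX ` \<Phi>)" "\<Phi> \<noteq> {}"
    and A3: "bounded (pD ` \<Phi>)"
    and A4: "\<exists>C>0. \<forall>p\<in>\<Phi>. j p \<ge> - C"
    and A5: "\<exists>U. open U \<and> \<Phi> \<subseteq> U \<and>
          (\<forall>p\<in>U. (j has_derivative blinfun_apply (j' p)) (at p)) \<and> continuous_on U j'"
    and A6: "\<And>p (u :: nat \<Rightarrow> 'w). p \<in> \<Phi> \<Longrightarrow>
          weak_lim (\<lambda>i. pX (u i)) 0 \<Longrightarrow> weak_star_lim J (\<lambda>i. pD (u i)) 0 \<Longrightarrow>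
          (\<lambda>i. blinfun_apply (j' p) (u i)) \<longlonglongrightarrow> 0"
    and A7: "\<And>k. sym_pos_def_form (a k)"
    and A8: "\<exists>c1>0. \<forall>p k. c1 * (norm (pX p))\<^sup>2 \<le> (form_norm (a k) p)\<^sup>2"
    and A9: "\<And>k. \<exists>c2. \<forall>p. (form_norm (a k) p)\<^sup>2 \<le> c2 * (norm p)\<^sup>2"
    and A10: "\<And>k p (y :: nat \<Rightarrow> 'w) z. p \<in> \<Phi> \<Longrightarrow> (\<And>i. y i \<in> \<Phi>) \<Longrightarrow>
          weak_lim (\<lambda>i. pX (y i)) (pX z) \<Longrightarrow> weak_star_lim J (\<lambda>i. pD (y i)) (pD z) \<Longrightarrow>
          (\<lambda>i. a k p (y i)) \<longlonglongrightarrow> a k p z"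
    and A11: "\<And>(r :: nat \<Rightarrow> nat) (p :: nat \<Rightarrow> 'w) (y :: nat \<Rightarrow> 'w).
          strict_mono r \<Longrightarrow> convergent (\<phi> \<circ> r) \<Longrightarrow>
          (\<lambda>i. pX (p i)) \<longlonglongrightarrow> 0 \<Longrightarrow> weak_star_lim J (\<lambda>i. pD (p i)) 0 \<Longrightarrow> convergent y \<Longrightarrow>
          (\<lambda>i. a (r i) (p i) (y i)) \<longlonglongrightarrow> 0"
    and A12: "\<exists>lmin lmax. 0 < lmin \<and> (\<forall>k. lmin \<le> lam k \<and> lam k \<le> lmax)"
    and \<beta>: "0 < \<beta>" "\<beta> < 1"
    and \<sigma>: "0 < \<sigma>" "\<sigma> < 1"
    and run: "vmpt_run pX \<Phi> j j' \<beta> \<sigma> 0 a lam \<phi> v"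
  shows "convergent (\<lambda>k. j (\<phi> k)) \<and>
    (\<forall>p. accumulation_point \<phi> p \<longrightarrow> stationary_point \<Phi> j' p) \<and>
    (\<forall>r p. strict_mono (r :: nat \<Rightarrow> nat) \<and> (\<phi> \<circ> r) \<longlonglongrightarrow> p \<and> stationary_point \<Phi> j' p \<longrightarrow>
      (\<lambda>i. pX (v (r i))) \<longlonglongrightarrow> 0) \<and>
    ((\<exists>\<gamma> L. 0 < \<gamma> \<and> \<gamma> \<le> 1 \<and> 0 \<le> L \<and>
        (\<forall>p\<in>\<Phi>. \<forall>q\<in>\<Phi>. norm (j' p - j' q) \<le> L * norm (p - q) powr \<gamma>)) \<longrightarrow>
      (\<lambda>k. pX (v k)) \<longlonglongrightarrow> 0)"
proof -
  obtain M where M: "\<And>p. p \<in> \<Phi> \<Longrightarrow> norm (pD p) \<le> M"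
    using A3 by (auto simp: bounded_iff)
  obtain C where C: "\<And>p. p \<in> \<Phi> \<Longrightarrow> j p \<ge> - C"
    using A4 by blast
  obtain U where U: "open U" "\<Phi> \<subseteq> U" "continuous_on U j'"
    "\<And>p. p \<in> U \<Longrightarrow> (j has_derivative blinfun_apply (j' p)) (at p)"
    using A5 by blast
  obtain c where c: "c > 0" "\<And>p k. c * (norm (pX p))\<^sup>2 \<le> (form_norm (a k) p)\<^sup>2"
    using A8 by blast
  obtain lmin lmax where l: "0 < lmin" "\<And>k. lmin \<le> lam k" "\<And>k. lam k \<le> lmax"
    using A12 by blast
  interpret banach_intersection iX iD pX pD by (fact spaces)
  interpret vmpt_iterates iX iD pX pD \<Phi> U j j' a lam \<beta> \<sigma> M C c lmin lmax \<phi> v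
    by unfold_locales (fact A2 M C U A7 c l \<beta> \<sigma> run)+
  have stationary: "stationary_point \<Phi> j' p" if acc: "accumulation_point \<phi> p" for p
  proof -
    obtain r where r: "strict_mono r" "(\<phi> \<circ> r) \<longlonglongrightarrow> p"
      using acc by (auto simp: accumulation_point_def)
    have "norm (pD (v k)) \<le> 2 * M" for k
      using D_norm_direction_le by blast
    then have weak_star: "weak_star_lim J (\<lambda>i. pD (v (r i))) 0"
      by (intro weak_star_null_if_strong_null_bounded[OF spaces A1_dual A1_compatible
            direction_null[OF r]]) auto
    have "(\<lambda>i. a (r i) (v (r i)) (\<eta> - \<phi> (r i))) \<longlonglongrightarrow> 0" for \<eta>
      using tendsto_diff[OF tendsto_const[of \<eta>] r(2)]
      by (intro A11[OF r(1) _ direction_null[OF r] weak_star])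
        (auto simp: convergent_def o_def intro: r(2)[unfolded o_def])
    then show ?thesis
      by (intro limit_stationary[OF r])
  qed
  show ?thesis
    using values_converge stationary direction_null all_directions_null by blast
qed

end
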